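(* Let $p(z)=\sum_{i=0}^{d}p_iz^i$ be a complex polynomial of degree $d\ge 1$ with $p_0\neq 0$ and $p_d\ne 0$, and let $\max_{0\le i\le d}|p_i|x^i=\max_{0\le i\le t}|p_{k_i}|x^{k_i}$ ($x\ge 0$) be its associated tropical (max-times) polynomial, where $0=k_0<k_1<\cdots<k_t=d$ are the Newton polygon indices of $p$ and $$\tau_\ell=\left(\frac{|p_{k_{\ell-1}}|}{|p_{k_\ell}|}\right)^{1/(k_\ell-k_{\ell-1})},\qquad \ell=1,\ldots,t,$$ are the tropical roots (see context). For $i=0,\ldots,d$ let $$\gamma_i=\min_{|z|>0}\beta_i(z),\qquad \beta_i(z)=\begin{cases}\displaystyle\max_{0\le j\le d}\frac{|p_jz^j|}{|p_iz^i|}&\text{if }p_i\ne0,\\[2mm] \displaystyle\max_{0\le j\le d}\frac{|p_jz^j|}{|z|^i}&\text{if }p_i=0.\end{cases}$$ Then for each $i\in\{1,\ldots,d\}$ and corresponding $\ell\in\{1,\ldots,t\}$ such that $k_{\ell-1}\le i\le k_\ell$, $$\gamma_i=\begin{cases}\displaystyle\frac{\tau_\ell^{k_{\ell-1}}|p_{k_{\ell-1}}|}{\tau_\ell^{i}|p_i|}=\frac{\tau_\ell^{k_{\ell}}|p_{k_{\ell}}|}{\tau_\ell^{i}|p_i|}&\text{if }p_i\neq0,\\[3mm] \displaystyle\frac{\tau_\ell^{k_{\ell-1}}|p_{k_{\ell-1}}|}{\tau_\ell^{i}}=\frac{\tau_\ell^{k_{\ell}}|p_{k_{\ell}}|}{\tau_\ell^{i}}&\text{if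 }p_i=0.\end{cases}$$
   Context: Newton polygon indices: consider the upper boundary of the convex hull of the points $(j,\log|p_j|)$, $0\le j\le d$, $p_j\neq 0$ (i.e. with the convention $\log 0=-\infty$). This is the graph of a concave piecewise linear function on $[0,d]$; its vertices (breakpoints, including the two endpoints) are the points $(k_\ell,\log|p_{k_\ell}|)$, $\ell=0,\ldots,t$, with $0=k_0<k_1<\cdots<k_t=d$. The opposites of the slopes of its segments are the logarithms of the tropical roots, so that the tropical roots are $\tau_\ell=(|p_{k_{\ell-1}}|/|p_{k_\ell}|)^{1/m_\ell}$ with multiplicity $m_\ell=k_\ell-k_{\ell-1}$, and $0<\tau_1<\cdots<\tau_t$. *)

theory Defs
  imports "HOL-Analysis.Analysis" "HOL-Computational_Algebra.Polynomial"
begin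

definition tropical_poly :: "complex poly \<Rightarrow> real \<Rightarrow> real" where
  "tropical_poly p x = Max ((\<lambda>i. cmod (coeff p i) * x ^ i) ` {0..degree p})"

(* Indices with zero coefficient are left out, as if ln 0 were minus infinity
   (in HOL, ln 0 = 0). *)
definition newton_points :: "complex poly \<Rightarrow> (real \<times> real) set" where
  "newton_points p = {(real j, ln (cmod (coeff p j))) | j. j \<le> degree p \<and> coeff p j \<noteq> 0}"

(* The function whose graph over [0, degree p] is the upper boundary of the convex hull;
   it is only meaningful on that interval and for coeff p 0 nonzero. *)
definition newton_polygon :: "complex poly \<Rightarrow> real \<Rightarrow> real" where
  "newton_polygon p x = Sup {y. (x, y) \<in> convex hull (newton_points p)}"

(* The two endpoints, and the interior points near which the function is not affine. *)
definition newton_vertices :: "complex poly \<Rightarrow> (real \<times> real) set" where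
  "newton_vertices p =
     {(x, newton_polygon p x) | x.
        x = 0 \<or> x = real (degree p) \<or>
        (0 < x \<and> x < real (degree p) \<and>
         \<not> (\<exists>e>0. \<exists>a b. \<forall>y\<in>{0..real (degree p)}. \<bar>y - x\<bar> < e \<longrightarrow> newton_polygon p y = a * y + b))}"

definition newton_indices :: "complex poly \<Rightarrow> nat \<Rightarrow> (nat \<Rightarrow> nat) \<Rightarrow> bool" where
  "newton_indices p t k \<longleftrightarrow>
     k 0 = 0 \<and> k t = degree p \<and> strict_mono_on {0..t} k \<and>
     (\<forall>l\<in>{0..t}. coeff p (k l) \<noteq> 0) \<and>
     newton_vertices p = (\<lambda>l. (real (k l), ln (cmod (coeff p (k l))))) ` {0..t}"

(* Only meaningful for l between 1 and t, where newton_indices p t k. *)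
definition tropical_root :: "complex poly \<Rightarrow> (nat \<Rightarrow> nat) \<Rightarrow> nat \<Rightarrow> real" where
  "tropical_root p k l =
     (cmod (coeff p (k (l - 1))) / cmod (coeff p (k l))) powr (1 / real (k l - k (l - 1)))"

definition beta :: "complex poly \<Rightarrow> nat \<Rightarrow> complex \<Rightarrow> real" where
  "beta p i z =
     (if coeff p i \<noteq> 0
      then Max ((\<lambda>j. cmod (coeff p j * z ^ j) / cmod (coeff p i * z ^ i)) ` {0..degree p})
      else Max ((\<lambda>j. cmod (coeff p j * z ^ j) / cmod z ^ i) ` {0..degree p}))"

(* A minimum over an infinite set, hence LEAST rather than Min; it is unspecified unless
   the minimum is attained. *)
definition gamma :: "complex poly \<Rightarrow> nat \<Rightarrow> real" where
  "gamma p i = (LEAST v. \<exists>z. cmod z > 0 \<and> v = beta p i z)"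

end

(* On the open interval between consecutive vertices the Newton polygon is locally affine, hence
   affine, and by convexity of the hull the line extending it lies above every point
   (j, ln |p_j|).  Since that line has slope -ln tau, exponentiating gives
   |p_j| tau^j <= |p_a| tau^a = |p_b| tau^b for all j, where a, b are the neighbouring indices.
   So the claimed value is beta_i at |z| = tau.  It is minimal because, for a <= i <= b, the
   terms with j = a and j = b of beta_i are nonincreasing and nondecreasing in |z|, respectively. *)
theory Submission
  imports Defs
begin

section \<open>Affine functions and upper boundaries of planar convex sets\<close>

text \<open>Near each point of \<open>S\<close> the slope of \<open>f\<close> is constant, so
  \<open>deriv f\<close> has derivative zero on \<open>S\<close>. Convexity of \<open>S\<close> then
  makes \<open>deriv f\<close> a constant \<open>a\<close>, and likewise
  \<open>f x - a * x\<close>.\<close>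

lemma locally_affine_imp_affine:
  fixes f :: "real \<Rightarrow> real"
  assumes "convex S"
    and loc: "\<And>x. x \<in> S \<Longrightarrow> \<exists>e>0. \<exists>a b. \<forall>y. \<bar>y - x\<bar> < e \<longrightarrow> f y = a * y + b"
  obtains a b where "\<And>x. x \<in> S \<Longrightarrow> f x = a * x + b"
proof -
  have *: "(f has_real_derivative deriv f x) (at x) \<and> (deriv f has_real_derivative 0) (at x)"
    if x: "x \<in> S" for x
  proof -
    obtain e a b where "e > 0" and f: "\<And>y. \<bar>y - x\<bar> < e \<Longrightarrow> f y = a * y + b"
      using loc[OF x] by blast
    \<comment> \<open>The first derivative is computed on a whole ball, so that
      \<open>deriv f\<close> is known to be constant near \<open>x\<close> and can itself be
      differentiated there.\<close>
    have D: "(f has_real_derivative a) (at y)" if "y \<in> ball x e" for y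
    proof (rule has_field_derivative_transform_within_open[where S = "ball x e"])
      show "((\<lambda>y. a * y + b) has_real_derivative a) (at y)"
        by (auto intro!: derivative_eq_intros)
    qed (use that f in \<open>auto simp: dist_real_def abs_minus_commute\<close>)
    have "(deriv f has_real_derivative 0) (at x)"
      by (rule has_field_derivative_transform_within_open[where S = "ball x e" and f = "\<lambda>_. a"])
        (use D \<open>e > 0\<close> in \<open>auto dest: DERIV_imp_deriv\<close>)
    with D[of x] \<open>e > 0\<close> show ?thesis
      by (auto dest: DERIV_imp_deriv)
  qed
  obtain a where a: "\<And>x. x \<in> S \<Longrightarrow> deriv f x = a"
    using has_field_derivative_zero_constant[OF \<open>convex S\<close>, of "deriv f"] *
    by (meson has_field_derivative_at_within)
  have "((\<lambda>x. f x - a * x) has_real_derivative 0) (at x within S)" if "x \<in> S" for x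
    using *[OF that] a[OF that]
    by (auto intro!: derivative_eq_intros intro: has_field_derivative_at_within)
  then obtain b where "\<And>x. x \<in> S \<Longrightarrow> f x - a * x = b"
    using has_field_derivative_zero_constant[OF \<open>convex S\<close>, of "\<lambda>x. f x - a * x"] by blast
  then show thesis
    by (intro that[of a b]) (auto simp: algebra_simps)
qed

lemma compact_slice:
  fixes H :: "(real \<times> real) set"
  assumes "compact H"
  shows "compact {y. (x, y) \<in> H}"
proof -
  have "{y. (x, y) \<in> H} = snd ` (H \<inter> ({x} \<times> UNIV))"
    by force
  moreover have "compact (H \<inter> ({x} \<times> UNIV))"
    by (intro compact_Int_closed assms closed_Times) auto
  ultimately show ?thesis
    by (simp add: compact_continuous_image continuous_on_snd)
qed

lemma le_Sup_slice:
  fixes H :: "(real \<times> real) set"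
  assumes "compact H" "(x, y) \<in> H"
  shows "y \<le> Sup {y. (x, y) \<in> H}"
  using compact_slice[OF \<open>compact H\<close>, of x] assms(2)
  by (auto intro!: cSup_upper simp: compact_imp_bounded bounded_imp_bdd_above)

text \<open>A vertical slice of a compact set is closed and bounded, so its supremum is attained
  once the slice is nonempty.\<close>

lemma Sup_slice_in:
  fixes H :: "(real \<times> real) set"
  assumes "compact H" "(x, y) \<in> H"
  shows "(x, Sup {y. (x, y) \<in> H}) \<in> H"
  using closed_contains_Sup[of "{y. (x, y) \<in> H}"] compact_slice[OF \<open>compact H\<close>, of x] assms(2)
  by (auto simp: compact_imp_closed compact_imp_bounded bounded_imp_bdd_above)

text \<open>If a point of \<open>H\<close> lay above the line, the segment joining it to a point of
  the line over \<open>(u, v)\<close> would run above the line while still over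
  \<open>(u, v)\<close>, against \<open>top\<close>.\<close>

lemma below_line_extending_upper_boundary:
  fixes H :: "(real \<times> real) set"
  assumes "convex H" "u < v"
    and mem: "\<And>x. u < x \<Longrightarrow> x < v \<Longrightarrow> (x, a * x + b) \<in> H"
    and top: "\<And>x y. u < x \<Longrightarrow> x < v \<Longrightarrow> (x, y) \<in> H \<Longrightarrow> y \<le> a * x + b"
    and xy: "(x, y) \<in> H"
  shows "y \<le> a * x + b"
proof -
  define m where "m = (u + v) / 2"
  \<comment> \<open>\<open>N\<close> is positive even if \<open>x = m\<close>. With
    \<open>s = (v - u) / (4 * N)\<close> the convex combination \<open>w\<close> of \<open>m\<close>
    and \<open>x\<close> stays within \<open>(v - u) / 4\<close> of the midpoint \<open>m\<close>,
    hence inside the interval.\<close>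
  define N where "N = \<bar>x - m\<bar> + (v - u)"
  define s where "s = (v - u) / (4 * N)"
  have m: "u < m" "m < v"
    using \<open>u < v\<close> by (auto simp: m_def)
  have N: "0 < N" "v - u \<le> N" "\<bar>x - m\<bar> \<le> N"
    using \<open>u < v\<close> by (auto simp: N_def)
  have s: "0 < s" "s \<le> 1"
    using N \<open>u < v\<close> by (auto simp: s_def)
  have "s * \<bar>x - m\<bar> \<le> s * N"
    using s N by (intro mult_left_mono) auto
  also have "\<dots> = (v - u) / 4"
    using N by (simp add: s_def)
  finally have "\<bar>s * (x - m)\<bar> \<le> (v - u) / 4"
    using s by (simp add: abs_mult)
  moreover define w where "w = (1 - s) * m + s * x"
  moreover have "w - m = s * (x - m)"
    by (simp add: w_def algebra_simps)
  ultimately have "w - m \<le> (v - u) / 4" "m - w \<le> (v - u) / 4"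
    by linarith+
  then have w: "u < w" "w < v"
    using \<open>u < v\<close> by (auto simp: m_def field_simps)
  have "(1 - s) *\<^sub>R (m, a * m + b) + s *\<^sub>R (x, y) \<in> H"
    using s by (intro convexD_alt[OF \<open>convex H\<close>] mem[OF m] xy) auto
  then have "(w, (1 - s) * (a * m + b) + s * y) \<in> H"
    by (simp add: w_def)
  \<comment> \<open>The height of the line at \<open>w\<close> is the same convex combination of its
    heights at \<open>m\<close> and \<open>x\<close>, so the contribution of \<open>m\<close>
    cancels.\<close>
  from top[OF w this] have "s * y \<le> s * (a * x + b)"
    by (simp add: w_def algebra_simps)
  then show ?thesis
    using s by simp
qed

text \<open>A continuous map sends the closure of the open interval into the closed set
  \<open>H\<close>. This reaches the end points of a segment, where local affinity may fail.\<close>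

lemma line_end_in_closed:
  fixes H :: "(real \<times> real) set"
  assumes "closed H" "u < v"
    and mem: "\<And>x. u < x \<Longrightarrow> x < v \<Longrightarrow> (x, a * x + b) \<in> H"
    and "x \<in> {u..v}"
  shows "(x, a * x + b) \<in> H"
proof -
  have "(\<lambda>x. (x, a * x + b)) ` closure {u<..<v} \<subseteq> H"
    by (rule image_closure_subset)
      (use assms in \<open>auto intro!: continuous_intros\<close>)
  then show ?thesis
    using \<open>u < v\<close> \<open>x \<in> {u..v}\<close> by (auto simp: image_subset_iff)
qed

section \<open>The Newton polygon and its segments\<close>

lemma compact_hull_newton_points: "compact (convex hull newton_points p)"
proof -
  have "newton_points p \<subseteq> (\<lambda>j. (real j, ln (cmod (coeff p j)))) ` {..degree p}"
    by (auto simp: newton_points_def)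
  then show ?thesis
    by (intro finite_imp_compact_convex_hull) (rule finite_subset, auto)
qed

text \<open>The constant and leading coefficients are nonzero, so the chord between the two extreme
  Newton points meets every vertical slice over the interval. The supremum is therefore
  attained.\<close>

lemma newton_polygon_mem_hull:
  assumes "coeff p 0 \<noteq> 0" "x \<in> {0..real (degree p)}"
  shows "(x, newton_polygon p x) \<in> convex hull newton_points p"
proof -
  let ?H = "convex hull newton_points p"
  have "coeff p (degree p) \<noteq> 0"
    using assms(1) by auto
  then have ends: "(0, ln (cmod (coeff p 0))) \<in> ?H"
      "(real (degree p), ln (cmod (coeff p (degree p)))) \<in> ?H"
    using assms(1) by (auto intro!: hull_inc simp: newton_points_def)
  obtain y where "(x, y) \<in> ?H"
  proof (cases "degree p = 0")
    case True
    then show thesis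
      using that ends assms(2) by auto
  next
    case False
    define s where "s = x / real (degree p)"
    have "0 \<le> s" "s \<le> 1" "x = s * real (degree p)"
      using assms(2) False by (auto simp: s_def)
    then show thesis
      using convexD_alt[OF convex_convex_hull ends, of s] that by auto
  qed
  then show ?thesis
    unfolding newton_polygon_def by (rule Sup_slice_in[OF compact_hull_newton_points])
qed

lemma newton_polygon_upper:
  "(x, y) \<in> convex hull newton_points p \<Longrightarrow> y \<le> newton_polygon p x"
  unfolding newton_polygon_def by (rule le_Sup_slice[OF compact_hull_newton_points])

lemma newton_indices_le_degree:
  assumes "newton_indices p t k" "l \<le> t"
  shows "k l \<le> degree p"
  using assms strict_mono_on_leD[of "{0..t}" k l t] by (auto simp: newton_indices_def)

lemma newton_indices_less:
  assumes "newton_indices p t k" "l \<in> {1..t}"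
  shows "k (l - 1) < k l"
  using assms by (auto simp: newton_indices_def intro!: strict_mono_onD[of "{0..t}" k])

lemma newton_polygon_index:
  assumes "newton_indices p t k" "l \<le> t"
  shows "newton_polygon p (real (k l)) = ln (cmod (coeff p (k l)))"
proof -
  have "(real (k l), ln (cmod (coeff p (k l)))) \<in> newton_vertices p"
    using assms by (auto simp: newton_indices_def)
  then show ?thesis
    by (auto simp: newton_vertices_def)
qed

text \<open>Monotonicity of \<open>k\<close> leaves no index strictly between two neighbours, so
  \<open>x\<close> is not the abscissa of a vertex.\<close>

lemma newton_polygon_locally_affine:
  assumes nk: "newton_indices p t k" and l: "l \<in> {1..t}"
    and x: "real (k (l - 1)) < x" "x < real (k l)"
  shows "\<exists>e>0. \<exists>a b. \<forall>y. \<bar>y - x\<bar> < e \<longrightarrow> newton_polygon p y = a * y + b"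
proof -
  have le: "k l \<le> degree p"
    using newton_indices_le_degree[OF nk] l by auto
  have x0: "0 < x" "x < real (degree p)"
    using x le by linarith+
  have "x \<noteq> real (k l')" if "l' \<le> t" for l'
  proof (cases "l' \<le> l - 1")
    case True
    then have "k l' \<le> k (l - 1)"
      using nk l by (intro strict_mono_on_leD[of "{0..t}" k]) (auto simp: newton_indices_def)
    then show ?thesis
      using x by auto
  next
    case False
    then have "k l \<le> k l'"
      using nk l that by (intro strict_mono_on_leD[of "{0..t}" k]) (auto simp: newton_indices_def)
    then show ?thesis
      using x by auto
  qed
  moreover have "newton_vertices p = (\<lambda>l. (real (k l), ln (cmod (coeff p (k l))))) ` {0..t}"
    using nk by (simp add: newton_indices_def)
  ultimately have "(x, newton_polygon p x) \<notin> newton_vertices p"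
    by fastforce
  with x0 obtain e a b where "e > 0" and e:
    "\<And>y. y \<in> {0..real (degree p)} \<Longrightarrow> \<bar>y - x\<bar> < e \<Longrightarrow> newton_polygon p y = a * y + b"
    unfolding newton_vertices_def by blast
  \<comment> \<open>Non-vertices give an affine formula only for \<open>y\<close> in
    \<open>{0..degree p}\<close>. Shrinking the radius keeps the whole neighbourhood in that
    interval.\<close>
  define e' where "e' = min e (min x (real (degree p) - x))"
  have "e' > 0"
    using \<open>e > 0\<close> x0 by (simp add: e'_def)
  moreover have "\<forall>y. \<bar>y - x\<bar> < e' \<longrightarrow> newton_polygon p y = a * y + b"
    by (auto simp: e'_def intro!: e)
  ultimately show ?thesis
    by blast
qed

text \<open>The line obtained is the supporting line of the hull along the \<open>l\<close>-th
  segment.\<close>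

lemma newton_segment_line:
  assumes p0: "coeff p 0 \<noteq> 0" and nk: "newton_indices p t k" and l: "l \<in> {1..t}"
  obtains a b where
    "\<And>j. coeff p j \<noteq> 0 \<Longrightarrow> ln (cmod (coeff p j)) \<le> a * real j + b"
    "ln (cmod (coeff p (k (l - 1)))) = a * real (k (l - 1)) + b"
    "ln (cmod (coeff p (k l))) = a * real (k l) + b"
proof -
  let ?H = "convex hull newton_points p"
  let ?u = "real (k (l - 1))" and ?v = "real (k l)"
  have uv: "?u < ?v"
    using newton_indices_less[OF nk l] by simp
  have vd: "?v \<le> real (degree p)"
    using newton_indices_le_degree[OF nk] l by simp
  obtain a b where ab: "\<And>x. x \<in> {?u<..<?v} \<Longrightarrow> newton_polygon p x = a * x + b"
    by (rule locally_affine_imp_affine[of "{?u<..<?v}" "newton_polygon p"])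
      (use newton_polygon_locally_affine[OF nk l] in auto)
  have mem: "(x, a * x + b) \<in> ?H" if "?u < x" "x < ?v" for x
    using newton_polygon_mem_hull[OF p0, of x] ab[of x] that vd by auto
  have top: "y \<le> a * x + b" if "?u < x" "x < ?v" "(x, y) \<in> ?H" for x y
    using newton_polygon_upper[OF that(3)] ab[of x] that by simp
  have below: "y \<le> a * x + b" if "(x, y) \<in> ?H" for x y
    using below_line_extending_upper_boundary[OF convex_convex_hull uv mem top that] .
  \<comment> \<open>The affine formula passes to the closed interval: the upper bound comes from
    \<open>below\<close>, the lower bound from closedness of the hull.\<close>
  have val: "newton_polygon p x = a * x + b" if "x \<in> {?u..?v}" for x
  proof (rule antisym)
    show "newton_polygon p x \<le> a * x + b"
      using that vd by (intro below newton_polygon_mem_hull[OF p0]) auto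
    show "a * x + b \<le> newton_polygon p x"
      using line_end_in_closed[OF compact_imp_closed[OF compact_hull_newton_points] uv mem that]
      by (rule newton_polygon_upper)
  qed
  show thesis
  proof
    fix j assume "coeff p j \<noteq> 0"
    then show "ln (cmod (coeff p j)) \<le> a * real j + b"
      by (intro below hull_inc) (auto simp: newton_points_def le_degree)
  next
    show "ln (cmod (coeff p (k (l - 1)))) = a * ?u + b"
      using newton_polygon_index[OF nk, of "l - 1"] val[of ?u] uv l by auto
    show "ln (cmod (coeff p (k l))) = a * ?v + b"
      using newton_polygon_index[OF nk, of l] val[of ?v] uv l by auto
  qed
qed

section \<open>Tropical roots and the minimum of \<open>beta\<close>\<close>

text \<open>The supporting line has slope \<open>- ln \<tau>\<close>. Exponentiating its inequality
  bounds every term by \<open>exp b\<close>, with equality at both ends of the segment.\<close>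

lemma tropical_root_dominates:
  assumes p0: "coeff p 0 \<noteq> 0" and nk: "newton_indices p t k" and l: "l \<in> {1..t}"
  defines "\<tau> \<equiv> tropical_root p k l"
  shows tropical_root_pos: "0 < \<tau>"
    and tropical_root_balance:
      "cmod (coeff p (k (l - 1))) * \<tau> ^ k (l - 1) = cmod (coeff p (k l)) * \<tau> ^ k l"
    and tropical_root_max: "cmod (coeff p j) * \<tau> ^ j \<le> cmod (coeff p (k l)) * \<tau> ^ k l"
proof -
  obtain a b where ab:
    "\<And>j. coeff p j \<noteq> 0 \<Longrightarrow> ln (cmod (coeff p j)) \<le> a * real j + b"
    "ln (cmod (coeff p (k (l - 1)))) = a * real (k (l - 1)) + b"
    "ln (cmod (coeff p (k l))) = a * real (k l) + b"
    using newton_segment_line[OF p0 nk l] by blast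
  have nz: "coeff p (k (l - 1)) \<noteq> 0" "coeff p (k l) \<noteq> 0"
    using nk l by (auto simp: newton_indices_def)
  have less: "k (l - 1) < k l"
    using newton_indices_less[OF nk l] .
  \<comment> \<open>Taking the difference of the two end equations eliminates \<open>b\<close>. The
    natural-number subtraction in \<open>tropical_root\<close> is exact by
    \<open>less\<close>.\<close>
  have "ln \<tau> = (a * real (k (l - 1)) - a * real (k l)) / (real (k l) - real (k (l - 1)))"
    using nz less by (simp add: \<tau>_def tropical_root_def ln_powr ln_div ab of_nat_diff del: One_nat_def)
  also have "\<dots> = - a"
    using less by (simp add: field_simps)
  finally have ln_tau: "ln \<tau> = - a" .
  show pos: "0 < \<tau>"
    using nz by (auto simp: \<tau>_def tropical_root_def)
  have eq: "cmod (coeff p j) * \<tau> ^ j = exp (ln (cmod (coeff p j)) - a * real j)"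
    if "coeff p j \<noteq> 0" for j
  proof -
    have "\<tau> ^ j = exp (- a * real j)"
      using pos by (metis exp_ln exp_of_nat2_mult ln_tau)
    then show ?thesis
      using that by (simp add: exp_diff exp_minus field_simps)
  qed
  show "cmod (coeff p (k (l - 1))) * \<tau> ^ k (l - 1) = cmod (coeff p (k l)) * \<tau> ^ k l"
    using nz by (simp add: eq ab del: One_nat_def)
  show "cmod (coeff p j) * \<tau> ^ j \<le> cmod (coeff p (k l)) * \<tau> ^ k l"
  \<comment> \<open>A zero coefficient has no Newton point, so the line gives no bound for it; its
    term is simply 0.\<close>
  proof (cases "coeff p j = 0")
    case False
    then show ?thesis
      using ab(1)[OF False] by (simp add: eq[OF False] eq[OF nz(2)] ab(3))
  qed (use pos in auto)
qed

text \<open>After division by \<open>r ^ i\<close> the \<open>a\<close>-term is nonincreasing in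
  \<open>r\<close> and the \<open>b\<close>-term nondecreasing. They agree at \<open>\<tau>\<close>,
  so the first gives the bound for \<open>r \<le> \<tau>\<close> and the second beyond.\<close>

lemma balanced_value_le_max:
  fixes A B r \<tau> :: real
  assumes "0 \<le> A" "0 \<le> B" "0 < \<tau>" "0 < r" "a \<le> i" "i \<le> b"
    and bal: "A * \<tau> ^ a = B * \<tau> ^ b"
  shows "B * \<tau> ^ b / \<tau> ^ i \<le> max (A * r ^ a / r ^ i) (B * r ^ b / r ^ i)"
proof (cases "r \<le> \<tau>")
  case True
  have eq: "A * x ^ a / x ^ i = A / x ^ (i - a)" if "x > 0" for x
    using that \<open>a \<le> i\<close> by (simp add: power_diff)
  have "A / \<tau> ^ (i - a) \<le> A / r ^ (i - a)"
    using assms True by (intro divide_left_mono power_mono) auto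
  then show ?thesis
    using assms by (simp add: eq flip: bal)
next
  case False
  have eq: "B * x ^ b / x ^ i = B * x ^ (b - i)" if "x > 0" for x
    using that \<open>i \<le> b\<close> by (simp add: power_diff)
  have "B * \<tau> ^ (b - i) \<le> B * r ^ (b - i)"
    using assms False by (intro mult_left_mono power_mono) auto
  then show ?thesis
    using assms by (simp add: eq)
qed

lemma newton_segment_exists:
  assumes "newton_indices p t k" "1 \<le> degree p" "i \<le> degree p"
  obtains l where "l \<in> {1..t}" "k (l - 1) \<le> i" "i \<le> k l"
proof -
  have k: "k 0 = 0" "k t = degree p"
    using assms by (auto simp: newton_indices_def)
  have t: "1 \<le> t"
    using k assms(2) by (cases t) auto
  define l where "l = (LEAST l. i \<le> k l)"
  have l: "i \<le> k l" "l \<le> t"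
    using LeastI[of "\<lambda>l. i \<le> k l" t] Least_le[of "\<lambda>l. i \<le> k l" t] k assms(3)
    by (auto simp: l_def)
  show thesis
  proof (cases "l = 0")
    \<comment> \<open>Here \<open>i = 0\<close>. Segments are numbered from 1, so the first one,
      with left end \<open>k 0 = 0\<close>, is taken.\<close>
    case True
    then show thesis
      using that[of 1] l k t by auto
  next
    case False
    then have "\<not> i \<le> k (l - 1)"
      unfolding l_def by (intro not_less_Least) auto
    then show thesis
      using that[of l] l False by auto
  qed
qed

text \<open>The weight \<open>w\<close> merges the two cases of \<open>beta\<close>, so that zero
  and nonzero \<open>coeff p i\<close> can be treated together.\<close>

lemma beta_eq:
  assumes "w = (if coeff p i \<noteq> 0 then cmod (coeff p i) else 1)"
  shows "beta p i z =
    Max ((\<lambda>j. cmod (coeff p j) * cmod z ^ j / (cmod z ^ i * w)) ` {0..degree p})"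
  using assms by (simp add: beta_def norm_mult norm_power mult.commute)

text \<open>At \<open>\<tau>\<close> the term \<open>j = k l\<close> dominates all others. For any
  other admissible \<open>z\<close>, the two terms at the ends of the segment already force the
  lower bound.\<close>

lemma beta_minimum:
  assumes p0: "coeff p 0 \<noteq> 0" and nk: "newton_indices p t k" and l: "l \<in> {1..t}"
    and i: "k (l - 1) \<le> i" "i \<le> k l"
    and w: "w = (if coeff p i \<noteq> 0 then cmod (coeff p i) else 1)"
  defines "\<tau> \<equiv> tropical_root p k l"
  defines "V \<equiv> \<tau> ^ k l * cmod (coeff p (k l)) / (\<tau> ^ i * w)"
  shows beta_at_tropical_root: "beta p i (of_real \<tau>) = V"
    and beta_ge: "cmod z > 0 \<Longrightarrow> V \<le> beta p i z"
proof -
  have pos: "0 < \<tau>" and w_pos: "0 < w"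
    using tropical_root_pos[OF p0 nk l] w by (auto simp: \<tau>_def)
  have le: "k (l - 1) \<le> degree p" "k l \<le> degree p"
    using newton_indices_le_degree[OF nk] l by auto
  show "beta p i (of_real \<tau>) = V"
    unfolding beta_eq[OF w]
  proof (rule Max_eqI)
    fix y assume "y \<in> (\<lambda>j. cmod (coeff p j) * cmod (of_real \<tau>) ^ j / (cmod (of_real \<tau>) ^ i * w)) ` {0..degree p}"
    then obtain j where y: "y = cmod (coeff p j) * \<tau> ^ j / (\<tau> ^ i * w)"
      using pos by auto
    show "y \<le> V"
      unfolding y V_def using tropical_root_max[OF p0 nk l, of j] pos w_pos
      by (intro divide_right_mono) (auto simp: \<tau>_def mult.commute)
  next
    show "V \<in> (\<lambda>j. cmod (coeff p j) * cmod (of_real \<tau>) ^ j / (cmod (of_real \<tau>) ^ i * w)) ` {0..degree p}"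
      using pos le by (auto simp: V_def mult.commute intro!: image_eqI[of _ _ "k l"])
  qed auto
  assume z: "cmod z > 0"
  define T where "T j = cmod (coeff p j) * cmod z ^ j / (cmod z ^ i * w)" for j
  have "V = cmod (coeff p (k l)) * \<tau> ^ k l / \<tau> ^ i / w"
    by (simp add: V_def mult.commute)
  also have "\<dots> \<le> max (cmod (coeff p (k (l - 1))) * cmod z ^ k (l - 1) / cmod z ^ i)
      (cmod (coeff p (k l)) * cmod z ^ k l / cmod z ^ i) / w"
    using tropical_root_balance[OF p0 nk l] pos z i w_pos
    by (intro divide_right_mono balanced_value_le_max) (auto simp: \<tau>_def)
  also have "\<dots> = max (T (k (l - 1))) (T (k l))"
    using w_pos by (simp add: T_def max_divide_distrib_right)
  also have "\<dots> \<le> beta p i z"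
    unfolding beta_eq[OF w] T_def using le by (intro max.boundedI Max_ge) auto
  finally show "V \<le> beta p i z" .
qed

section \<open>The tropical polynomial, and assembly of the theorem\<close>

text \<open>A term with index \<open>j\<close> in the \<open>l\<close>-th segment is controlled at
  \<open>\<tau>\<close> by the balanced value. Dividing by \<open>\<tau> ^ j\<close> and applying
  \<open>balanced_value_le_max\<close> bounds it at every \<open>x > 0\<close> by the two end
  terms.\<close>

lemma tropical_poly_newton:
  assumes "coeff p 0 \<noteq> 0" "1 \<le> degree p" and nk: "newton_indices p t k" and "0 \<le> x"
  shows "tropical_poly p x = Max ((\<lambda>l. cmod (coeff p (k l)) * x ^ k l) ` {0..t})"
    (is "_ = Max (?f ` _)")
  unfolding tropical_poly_def
proof (rule antisym)
  have "cmod (coeff p j) * x ^ j \<le> Max (?f ` {0..t})" if "j \<le> degree p" for j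
  proof (cases "x = 0")
    case True
    have "k 0 = 0"
      using nk by (simp add: newton_indices_def)
    then have "cmod (coeff p j) * x ^ j \<le> ?f 0"
      using True by (cases j) auto
    also have "\<dots> \<le> Max (?f ` {0..t})"
      by (rule Max_ge) auto
    finally show ?thesis .
  next
    case False
    then have x: "x > 0"
      using \<open>0 \<le> x\<close> by simp
    obtain l where l: "l \<in> {1..t}" "k (l - 1) \<le> j" "j \<le> k l"
      using newton_segment_exists[OF nk \<open>1 \<le> degree p\<close> \<open>j \<le> degree p\<close>] .
    note root = tropical_root_dominates[OF assms(1) nk l(1)]
    have "cmod (coeff p j)
        \<le> cmod (coeff p (k l)) * tropical_root p k l ^ k l / tropical_root p k l ^ j"
      using root(1) root(3)[of j] by (simp add: field_simps)
    also have "\<dots> \<le> max (?f (l - 1) / x ^ j) (?f l / x ^ j)"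
      using root x l by (intro balanced_value_le_max) auto
    also have "\<dots> = max (?f (l - 1)) (?f l) / x ^ j"
      using x by (simp add: max_divide_distrib_right)
    finally have "cmod (coeff p j) * x ^ j \<le> max (?f (l - 1)) (?f l)"
      using x by (simp add: field_simps)
    also have "\<dots> \<le> Max (?f ` {0..t})"
      using l by (intro max.boundedI Max_ge) auto
    finally show ?thesis .
  qed
  then show "Max ((\<lambda>i. cmod (coeff p i) * x ^ i) ` {0..degree p}) \<le> Max (?f ` {0..t})"
    by (intro Max.boundedI) auto
  show "Max (?f ` {0..t}) \<le> Max ((\<lambda>i. cmod (coeff p i) * x ^ i) ` {0..degree p})"
    using newton_indices_le_degree[OF nk] by (intro Max_mono) auto
qed

text \<open>The second conjunct shows that the minimum is attained, so the \<open>LEAST\<close> in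
  \<open>gamma\<close> is meaningful. An interior vertex index \<open>i\<close> lies in two adjacent
  segments, and the formula holds for both choices of \<open>l\<close>.\<close>

theorem theorem1:
  fixes p :: "complex poly" and d t :: nat and k :: "nat \<Rightarrow> nat"
  assumes "degree p = d" and "d \<ge> 1" and "coeff p 0 \<noteq> 0" and "coeff p d \<noteq> 0"
    and "newton_indices p t k"
  shows "(\<forall>x\<ge>0. tropical_poly p x = Max ((\<lambda>l. cmod (coeff p (k l)) * x ^ k l) ` {0..t})) \<and>
    (\<forall>i\<in>{0..d}. \<exists>z. is_arg_min (beta p i) (\<lambda>z. cmod z > 0) z) \<and>
    (\<forall>i\<in>{1..d}. \<forall>l\<in>{1..t}. k (l - 1) \<le> i \<and> i \<le> k l \<longrightarrow>
           (let \<tau> = tropical_root p k l in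
            if coeff p i \<noteq> 0
            then gamma p i = \<tau> ^ k (l - 1) * cmod (coeff p (k (l - 1))) / (\<tau> ^ i * cmod (coeff p i))
               \<and> gamma p i = \<tau> ^ k l * cmod (coeff p (k l)) / (\<tau> ^ i * cmod (coeff p i))
            else gamma p i = \<tau> ^ k (l - 1) * cmod (coeff p (k (l - 1))) / \<tau> ^ i
               \<and> gamma p i = \<tau> ^ k l * cmod (coeff p (k l)) / \<tau> ^ i))"
proof (intro conjI ballI allI impI)
  have d: "1 \<le> degree p"
    using assms by simp
  note nk = \<open>newton_indices p t k\<close> and p0 = \<open>coeff p 0 \<noteq> 0\<close>
  show "tropical_poly p x = Max ((\<lambda>l. cmod (coeff p (k l)) * x ^ k l) ` {0..t})" if "x \<ge> 0" for x
    using tropical_poly_newton[OF p0 d nk that] .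
  show "\<exists>z. is_arg_min (beta p i) (\<lambda>z. cmod z > 0) z" if i: "i \<in> {0..d}" for i
  proof -
    obtain l where l: "l \<in> {1..t}" "k (l - 1) \<le> i" "i \<le> k l"
      using newton_segment_exists[OF nk d, of i] i \<open>degree p = d\<close> by auto
    show ?thesis
      using tropical_root_pos[OF p0 nk l(1)] beta_minimum[OF p0 nk l refl]
      by (intro exI[of _ "of_real (tropical_root p k l)"])
        (auto simp: is_arg_min_linorder)
  qed
  fix i l assume l: "l \<in> {1..t}" and i: "k (l - 1) \<le> i \<and> i \<le> k l"
  define \<tau> where "\<tau> = tropical_root p k l"
  define w where "w = (if coeff p i \<noteq> 0 then cmod (coeff p i) else 1)"
  note min = beta_minimum[OF p0 nk l conjunct1[OF i] conjunct2[OF i] w_def, folded \<tau>_def]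
  have "gamma p i = \<tau> ^ k l * cmod (coeff p (k l)) / (\<tau> ^ i * w)"
    unfolding gamma_def
  proof (rule Least_equality)
    show "\<exists>z. cmod z > 0 \<and> \<tau> ^ k l * cmod (coeff p (k l)) / (\<tau> ^ i * w) = beta p i z"
      using tropical_root_pos[OF p0 nk l] min(1)
      by (intro exI[of _ "of_real \<tau>"]) (auto simp: \<tau>_def)
  qed (use min(2) in auto)
  \<comment> \<open>Balance at the tropical root converts the right-end formula into the left-end
    one.\<close>
  moreover have "\<tau> ^ k l * cmod (coeff p (k l)) = \<tau> ^ k (l - 1) * cmod (coeff p (k (l - 1)))"
    using tropical_root_balance[OF p0 nk l] by (simp add: \<tau>_def mult.commute)
  ultimately show "let \<tau> = tropical_root p k l in
      if coeff p i \<noteq> 0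
      then gamma p i = \<tau> ^ k (l - 1) * cmod (coeff p (k (l - 1))) / (\<tau> ^ i * cmod (coeff p i))
         \<and> gamma p i = \<tau> ^ k l * cmod (coeff p (k l)) / (\<tau> ^ i * cmod (coeff p i))
      else gamma p i = \<tau> ^ k (l - 1) * cmod (coeff p (k (l - 1))) / \<tau> ^ i
         \<and> gamma p i = \<tau> ^ k l * cmod (coeff p (k l)) / \<tau> ^ i"
    by (simp add: Let_def w_def flip: \<tau>_def)
qed

end
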